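(* Let $\mathcal L$ be a positive definite linear functional on $\prod^{N,M}$ with vector orthonormal polynomials $\{\Phi_{n,m}\}$, $\{\tilde\Phi_{n,m}\}$ as in the context. For $1\le n\le N$, $1\le m\le M$ and all $z,w,z_1,w_1\in\mathbb{C}$, $$\overleftarrow\Phi_{n,m}(z,w)\overleftarrow\Phi_{n,m}(z_1,w_1)^\dagger-\bar z_1z\,\Phi_{n,m}(z,w)^T\overline{\Phi_{n,m}(z_1,w_1)}$$ $$=(1-\bar z_1z)\Phi_{n,m}(z,w)^T\overline{\Phi_{n,m}(z_1,w_1)}+\overleftarrow\Phi_{n-1,m}(z,w)\overleftarrow\Phi_{n-1,m}(z_1,w_1)^\dagger-\bar z_1z\,\Phi_{n-1,m}(z,w)^T\overline{\Phi_{n-1,m}(z_1,w_1)}$$ $$=(1-\bar z_1z)\tilde\Phi_{n,m}(z,w)^T\overline{\tilde\Phi_{n,m}(z_1,w_1)}+\overleftarrow\Phi_{n,m-1}(z,w)\overleftarrow\Phi_{n,m-1}(z_1,w_1)^\dagger-\bar z_1z\,\Phi_{n,m-1}(z,w)^T\overline{\Phi_{n,m-1}(z_1,w_1)}.$$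
   Context: $\prod^{N,M}=\mathrm{span}\{z^iw^j:|i|\le N,|j|\le M\}$, $\hat\prod^{N,M}=\mathrm{span}\{z^iw^j:0\le i\le N,0\le j\le M\}$. A linear functional $\mathcal L$ on $\prod^{N,M}$ with $\mathcal L(z^{-i}w^{-j})=\overline{\mathcal L(z^iw^j)}$ is positive definite if $\langle p,p\rangle>0$ for all nonzero $p\in\hat\prod^{N,M}$, where $\langle p,q\rangle=\mathcal L\big(p(z,w)\,\overline{q(1/\bar z,1/\bar w)}\big)$. For $0\le l\le m$, $\phi^l_{n,m}$ is the unique element of $\mathrm{span}(\{z^iw^j:0\le i<n,0\le j\le m\}\cup\{z^nw^j:0\le j\le l\})$ with positive coefficient of $z^nw^l$, $\langle\phi^l_{n,m},\phi^l_{n,m}\rangle=1$, orthogonal to all of these monomials except $z^nw^l$; $\Phi_{n,m}=[\phi^m_{n,m},\dots,\phi^0_{n,m}]^T$. For $0\le l\le n$, $\tilde\phi^l_{n,m}$ is the unique element of $\mathrm{span}(\{z^iw^j:0\le i\le n,0\le j<m\}\cup\{z^iw^m:0\le i\le l\})$ with positive coefficient of $z^lw^m$, norm one, orthogonal to all of these monomials except $z^lw^m$; $\tilde\Phi_{n,m}=[\tilde\phi^n_{n,m},\dots,\tilde\phi^0_{n,m}]^T$. The reversal is the row vector $\overleftarrow\Phi_{n,m}(z,w)=z^nw^m\Phi_{n,m}(1/\bar z,1/\bar w)^\dagger$. In the formulas $\overleftarrow\Phi(z_1,w_1)^\dagger$ and $\overline{\Phi(z_1,w_1)}$ are the conjugate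 transpose, respectively entrywise conjugate, of the value at $(z_1,w_1)$. *)

theory Defs
  imports
    "HOL-Library.Poly_Mapping"
    "HOL-Library.Product_Plus"
    "HOL-Library.Complex_Order"
    "Jordan_Normal_Form.Matrix"
begin

section \<open>Laurent polynomials in two variables\<close>

text \<open>The coefficient of \<open>z\<^sup>i w\<^sup>j\<close> in \<open>p\<close> is \<open>lookup p (i, j)\<close>; multiplication is the library's
  convolution product.\<close>

type_synonym laurent = "(int \<times> int) \<Rightarrow>\<^sub>0 complex"

abbreviation coef :: "laurent \<Rightarrow> int \<times> int \<Rightarrow> complex" where
  "coef \<equiv> Poly_Mapping.lookup"

definition mono2 :: "int \<times> int \<Rightarrow> laurent" where
  "mono2 k = Poly_Mapping.single k 1"

definition lscale :: "complex \<Rightarrow> laurent \<Rightarrow> laurent" where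
  "lscale c p = Poly_Mapping.map ((*) c) p"

lemma coef_lscale [simp]: "coef (lscale c p) k = c * coef p k"
  by (simp add: lscale_def Poly_Mapping.map.rep_eq when_def)

interpretation laurent: vector_space lscale
  by unfold_locales (auto intro!: poly_mapping_eqI simp: lookup_add algebra_simps)

text \<open>Evaluation is meaningful where \<open>z, w \<noteq> 0\<close>, and everywhere if all exponents are
  non-negative (note \<open>0 powi 0 = 1\<close>).\<close>

definition leval :: "laurent \<Rightarrow> complex \<Rightarrow> complex \<Rightarrow> complex" where
  "leval p z w = (\<Sum>(i, j)\<in>Poly_Mapping.keys p. coef p (i, j) * z powi i * w powi j)"

text \<open>\<open>lstar q\<close> is the Laurent polynomial \<open>cnj (q (1 / cnj z, 1 / cnj w))\<close>; see \<open>leval_lstar\<close>.\<close>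

definition lstar :: "laurent \<Rightarrow> laurent" where
  "lstar q = Poly_Mapping.map_key uminus (Poly_Mapping.map cnj q)"

lemma coef_lstar [simp]: "coef (lstar q) k = cnj (coef q (- k))"
  by (simp add: lstar_def Poly_Mapping.map.rep_eq when_def map_key.rep_eq inj_def)

lemma keys_lstar: "Poly_Mapping.keys (lstar q) = uminus ` Poly_Mapping.keys q"
proof (rule Set.set_eqI)
  fix k
  have "k \<in> Poly_Mapping.keys (lstar q) \<longleftrightarrow> - k \<in> Poly_Mapping.keys q"
    by (simp add: in_keys_iff)
  also have "\<dots> \<longleftrightarrow> k \<in> uminus ` Poly_Mapping.keys q"
    using minus_minus[of k] by (auto simp del: minus_minus simp: image_iff) (metis minus_minus)+
  finally show "k \<in> Poly_Mapping.keys (lstar q) \<longleftrightarrow> k \<in> uminus ` Poly_Mapping.keys q" .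
qed

lemma leval_lstar: "leval (lstar q) z w = cnj (leval q (1 / cnj z) (1 / cnj w))"
proof -
  have "leval (lstar q) z w
      = (\<Sum>k\<in>Poly_Mapping.keys q. coef (lstar q) (- k) * z powi fst (- k) * w powi snd (- k))"
    unfolding leval_def keys_lstar case_prod_beta prod.collapse
    by (subst sum.reindex) (simp_all add: inj_on_def)
  also have "\<dots> = cnj (leval q (1 / cnj z) (1 / cnj w))"
    unfolding leval_def case_prod_beta prod.collapse cnj_sum
    by (rule sum.cong) (simp_all add: power_int_minus power_int_inverse divide_inverse)
  finally show ?thesis .
qed

section \<open>Functionals and the inner product\<close>

text \<open>Functionals are total on type \<open>laurent\<close>, but only their values on \<open>LPi N M\<close> are constrained
  or used.\<close>

definition LPi :: "nat \<Rightarrow> nat \<Rightarrow> laurent set" where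
  "LPi N M = laurent.span (mono2 ` {(i, j). \<bar>i\<bar> \<le> int N \<and> \<bar>j\<bar> \<le> int M})"

definition LPi_hat :: "nat \<Rightarrow> nat \<Rightarrow> laurent set" where
  "LPi_hat N M = laurent.span (mono2 ` {(i, j). 0 \<le> i \<and> i \<le> int N \<and> 0 \<le> j \<and> j \<le> int M})"

definition linear_functional :: "nat \<Rightarrow> nat \<Rightarrow> (laurent \<Rightarrow> complex) \<Rightarrow> bool" where
  "linear_functional N M L \<longleftrightarrow>
     (\<forall>p\<in>LPi N M. \<forall>q\<in>LPi N M. L (p + q) = L p + L q) \<and>
     (\<forall>c. \<forall>p\<in>LPi N M. L (lscale c p) = c * L p)"

definition hermitian_functional :: "nat \<Rightarrow> nat \<Rightarrow> (laurent \<Rightarrow> complex) \<Rightarrow> bool" where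
  "hermitian_functional N M L \<longleftrightarrow>
     (\<forall>i j. \<bar>i\<bar> \<le> int N \<and> \<bar>j\<bar> \<le> int M \<longrightarrow> L (mono2 (- i, - j)) = cnj (L (mono2 (i, j))))"

definition linner :: "(laurent \<Rightarrow> complex) \<Rightarrow> laurent \<Rightarrow> laurent \<Rightarrow> complex" where
  "linner L p q = L (p * lstar q)"

text \<open>The order on \<open>complex\<close> is that of \<open>Complex_Order\<close>: \<open>0 < c\<close> means that \<open>c\<close> is real and
  positive.\<close>

definition positive_definite :: "nat \<Rightarrow> nat \<Rightarrow> (laurent \<Rightarrow> complex) \<Rightarrow> bool" where
  "positive_definite N M L \<longleftrightarrow>
     linear_functional N M L \<and> hermitian_functional N M L \<and>
     (\<forall>p\<in>LPi_hat N M. p \<noteq> 0 \<longrightarrow> 0 < linner L p p)"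

section \<open>Vector orthonormal polynomials\<close>

definition is_orthonormal_poly ::
    "(laurent \<Rightarrow> complex) \<Rightarrow> (int \<times> int) set \<Rightarrow> int \<times> int \<Rightarrow> laurent \<Rightarrow> bool" where
  "is_orthonormal_poly L I e p \<longleftrightarrow>
     p \<in> laurent.span (mono2 ` I) \<and> 0 < coef p e \<and> linner L p p = 1 \<and>
     (\<forall>k\<in>I - {e}. linner L p (mono2 k) = 0)"

definition phi :: "(laurent \<Rightarrow> complex) \<Rightarrow> nat \<Rightarrow> nat \<Rightarrow> nat \<Rightarrow> laurent" where
  "phi L n m l = (THE p. is_orthonormal_poly L
     ({(i, j). 0 \<le> i \<and> i < int n \<and> 0 \<le> j \<and> j \<le> int m} \<union> {(int n, j) |j. 0 \<le> j \<and> j \<le> int l})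
     (int n, int l) p)"

definition phi_tilde :: "(laurent \<Rightarrow> complex) \<Rightarrow> nat \<Rightarrow> nat \<Rightarrow> nat \<Rightarrow> laurent" where
  "phi_tilde L n m l = (THE p. is_orthonormal_poly L
     ({(i, j). 0 \<le> i \<and> i \<le> int n \<and> 0 \<le> j \<and> j < int m} \<union> {(i, int m) |i. 0 \<le> i \<and> i \<le> int l})
     (int l, int m) p)"

definition Phi :: "(laurent \<Rightarrow> complex) \<Rightarrow> nat \<Rightarrow> nat \<Rightarrow> laurent vec" where
  "Phi L n m = vec (m + 1) (\<lambda>k. phi L n m (m - k))"

definition Phi_tilde :: "(laurent \<Rightarrow> complex) \<Rightarrow> nat \<Rightarrow> nat \<Rightarrow> laurent vec" where
  "Phi_tilde L n m = vec (n + 1) (\<lambda>k. phi_tilde L n m (n - k))"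

text \<open>The entries \<open>z\<^sup>n w\<^sup>m cnj (p (1 / cnj z, 1 / cnj w))\<close> are formed in the Laurent polynomial ring,
  so that for \<open>p\<close> in \<open>LPi_hat n m\<close> they are polynomials, with the right values also at \<open>z = 0\<close> or
  \<open>w = 0\<close>.\<close>

definition Phi_rev :: "(laurent \<Rightarrow> complex) \<Rightarrow> nat \<Rightarrow> nat \<Rightarrow> laurent vec" where
  "Phi_rev L n m = map_vec (\<lambda>p. mono2 (int n, int m) * lstar p) (Phi L n m)"

text \<open>With \<open>v \<bullet>c u = v \<bullet> conjugate u\<close>, the \<open>1 \<times> 1\<close> matrix product of a row vector and a column
  vector is identified with the scalar product. Thus \<open>F(z,w)\<^sup>T cnj (F(z\<^sub>1,w\<^sub>1))\<close> for a column
  vector \<open>F\<close> and \<open>G(z,w) G(z\<^sub>1,w\<^sub>1)\<^sup>\<dagger>\<close> for a row vector \<open>G\<close> are both rendered by \<open>vkernel\<close>.\<close>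

definition veval :: "laurent vec \<Rightarrow> complex \<Rightarrow> complex \<Rightarrow> complex vec" where
  "veval F z w = map_vec (\<lambda>p. leval p z w) F"

definition vkernel :: "laurent vec \<Rightarrow> complex \<Rightarrow> complex \<Rightarrow> complex \<Rightarrow> complex \<Rightarrow> complex" where
  "vkernel F z w z1 w1 = veval F z w \<bullet>c veval F z1 w1"

end

theory Submission
  imports Defs
begin

text \<open>
  Let \<open>K n m\<close> be the reproducing kernel of the span of the \<open>z\<^sup>i w\<^sup>j\<close> with \<open>i < n\<close>, \<open>j < m\<close>, that
  is, the sum of \<open>b(z,w) cnj (b(z\<^sub>1,w\<^sub>1))\<close> over any orthonormal basis. The entries of \<open>Phi n m\<close>
  extend an orthonormal basis from one such span to the next, so their kernel is
  \<open>K (n + 1) (m + 1) - K n (m + 1)\<close>; likewise that of \<open>Phi_tilde n m\<close> is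
  \<open>K (n + 1) (m + 1) - K (n + 1) m\<close>. Reversal is antiunitary on the span for \<open>(n + 1, m + 1)\<close> and
  maps the span for \<open>(n, m + 1)\<close> onto \<open>z\<close> times itself, so the kernel of \<open>Phi_rev n m\<close> is
  \<open>K (n + 1) (m + 1) - cnj z\<^sub>1 z K n (m + 1)\<close>. After substitution all three expressions equal
  \<open>(1 - cnj z\<^sub>1 z) K (n + 1) (m + 1)\<close>.
\<close>

section \<open>Laurent polynomials\<close>

lemma coef_mono2: "coef (mono2 k) i = (if k = i then 1 else 0)"
  by (simp add: mono2_def lookup_single when_def)

lemma mono2_zero: "mono2 0 = 1"
  by (simp add: mono2_def)

lemma mono2_mult: "mono2 a * mono2 b = mono2 (a + b)"
  by (simp add: mono2_def mult_single)

lemma lscale_mult_left: "lscale c p * q = lscale c (p * q)"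
  by (simp add: lscale_def mult_map_scale_conv_mult mult.assoc)

lemma lscale_mult_right: "p * lscale c q = lscale c (p * q)"
  by (simp add: lscale_def mult_map_scale_conv_mult mult.left_commute)

lemma keys_lscale: "Poly_Mapping.keys (lscale c p) \<subseteq> Poly_Mapping.keys p"
  by (auto simp: in_keys_iff)

lemma laurent_expand:
  assumes "finite A" "Poly_Mapping.keys p \<subseteq> A"
  shows "p = (\<Sum>k\<in>A. lscale (coef p k) (mono2 k))"
  using assms by (intro poly_mapping_eqI) (auto simp: lookup_sum coef_mono2 in_keys_iff if_distrib[where f = "(*) _"] cong: if_cong)

text \<open>The support condition is closed under linear combinations, and expansion into monomials
  gives the converse. Span membership becomes a condition on exponents, so that single terms can be
  split off.\<close>

lemma span_mono2: "laurent.span (mono2 ` I) = {p. Poly_Mapping.keys p \<subseteq> I}"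
proof (rule antisym)
  show "laurent.span (mono2 ` I) \<subseteq> {p. Poly_Mapping.keys p \<subseteq> I}"
  proof (rule laurent.span_minimal)
    show "mono2 ` I \<subseteq> {p. Poly_Mapping.keys p \<subseteq> I}"
      by (auto simp: mono2_def)
    show "laurent.subspace {p. Poly_Mapping.keys p \<subseteq> I}"
      unfolding laurent.subspace_def
      by (auto dest!: subsetD[OF keys_add] subsetD[OF keys_lscale])
  qed
  show "{p. Poly_Mapping.keys p \<subseteq> I} \<subseteq> laurent.span (mono2 ` I)"
  proof
    fix p :: laurent assume "p \<in> {p. Poly_Mapping.keys p \<subseteq> I}"
    then have "(\<Sum>k\<in>Poly_Mapping.keys p. lscale (coef p k) (mono2 k)) \<in> laurent.span (mono2 ` I)"
      by (intro laurent.span_sum laurent.span_scale laurent.span_base) auto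
    then show "p \<in> laurent.span (mono2 ` I)"
      using laurent_expand[of "Poly_Mapping.keys p" p] by simp
  qed
qed

abbreviation Pol :: "(int \<times> int) set \<Rightarrow> laurent set" where
  "Pol I \<equiv> laurent.span (mono2 ` I)"

lemma Pol_mono: "I \<subseteq> J \<Longrightarrow> p \<in> Pol I \<Longrightarrow> p \<in> Pol J"
  by (auto simp: span_mono2)

lemma mono2_in_Pol: "k \<in> I \<Longrightarrow> mono2 k \<in> Pol I"
  by (auto intro: laurent.span_base)

text \<open>Zero needs no case of its own, being the \<open>0\<close>-multiple of a
  monomial.\<close>

lemma laurent_induct [case_names mono add scale]:
  assumes "\<And>k. P (mono2 k)" "\<And>p q. P p \<Longrightarrow> P q \<Longrightarrow> P (p + q)" "\<And>c p. P p \<Longrightarrow> P (lscale c p)"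
  shows "P p"
proof -
  have "P 0" using assms(3)[OF assms(1), of 0] by simp
  have "p \<in> Pol UNIV" by (simp add: span_mono2)
  then show ?thesis
    by (induction rule: laurent.span_induct) (use assms \<open>P 0\<close> in \<open>auto simp: laurent.subspace_def\<close>)
qed

lemma lstar_add: "lstar (p + q) = lstar p + lstar q"
  by (rule poly_mapping_eqI) (simp add: lookup_add)

lemma lstar_lscale: "lstar (lscale c p) = lscale (cnj c) (lstar p)"
  by (rule poly_mapping_eqI) simp

lemma lstar_lstar [simp]: "lstar (lstar p) = p"
  by (rule poly_mapping_eqI) simp

lemma lstar_mono2: "lstar (mono2 k) = mono2 (- k)"
  by (rule poly_mapping_eqI) (simp add: coef_mono2 equation_minus_iff eq_commute)

lemma lstar_mult: "lstar (p * q) = lstar p * lstar q"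
proof (induction p rule: laurent_induct)
  case (mono k)
  show ?case
    by (induction q rule: laurent_induct)
      (auto simp: lstar_mono2 mono2_mult lstar_add lstar_lscale lscale_mult_right distrib_left add.commute)
qed (auto simp: lstar_add lstar_lscale lscale_mult_left distrib_right)

section \<open>Evaluation at a point\<close>

lemma leval_superset:
  assumes "finite A" "Poly_Mapping.keys p \<subseteq> A"
  shows "leval p z w = (\<Sum>(i, j)\<in>A. coef p (i, j) * z powi i * w powi j)"
  unfolding leval_def by (rule sum.mono_neutral_left) (use assms in \<open>auto simp: in_keys_iff\<close>)

lemma leval_add: "leval (p + q) z w = leval p z w + leval q z w"
  using keys_add[of p q]
  by (subst (1 2 3) leval_superset[where A = "Poly_Mapping.keys p \<union> Poly_Mapping.keys q"])
    (auto simp: lookup_add algebra_simps sum.distrib case_prod_beta)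

lemma leval_lscale: "leval (lscale c p) z w = c * leval p z w"
  using keys_lscale[of c p]
  by (subst (1 2) leval_superset[where A = "Poly_Mapping.keys p"])
    (auto simp: sum_distrib_left case_prod_beta mult.assoc)

lemma leval_zero: "leval 0 z w = 0"
  by (simp add: leval_def)

lemma leval_sum: "leval (sum f A) z w = (\<Sum>a\<in>A. leval (f a) z w)"
  by (induction A rule: infinite_finite_induct) (auto simp: leval_add leval_zero)

lemma leval_mono2: "leval (mono2 (i, j)) z w = z powi i * w powi j"
  by (subst leval_superset[where A = "{(i, j)}"]) (auto simp: mono2_def lookup_single)

text \<open>By linearity monomials suffice. Exponents of \<open>z\<close> are kept nonnegative so
  that the rule also holds at \<open>z = 0\<close>: from exponent -1 the left side would get
  \<open>0 powi 0 = 1\<close>, while the right side has a factor 0.\<close>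

lemma leval_z_mult:
  assumes "p \<in> Pol I" "\<And>i j. (i, j) \<in> I \<Longrightarrow> 0 \<le> i"
  shows "leval (mono2 (1, 0) * p) z w = z * leval p z w"
  using assms(1)
proof (induction rule: laurent.span_induct)
  case (step p)
  then obtain i j where "p = mono2 (i, j)" "(i, j) \<in> I" by auto
  with assms(2) show ?case
    by (auto simp: mono2_mult leval_mono2 power_int_add algebra_simps)
      (auto simp: power_int_def nat_add_distrib)
next
  case base
  show ?case
    by (auto simp: laurent.subspace_def leval_add leval_lscale leval_zero lscale_mult_right distrib_left)
qed

lemma mono2_mult_in_Pol:
  assumes "p \<in> Pol I" "\<And>i. i \<in> I \<Longrightarrow> k + i \<in> J"
  shows "mono2 k * p \<in> Pol J"
  using assms(1)
proof (induction rule: laurent.span_induct)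
  case (step p)
  then show ?case using assms(2) by (auto simp: mono2_mult intro!: mono2_in_Pol)
qed (auto simp: laurent.subspace_def lscale_mult_right distrib_left laurent.span_zero
       intro: laurent.span_add laurent.span_scale)

text \<open>The order of the entries does not affect the sum. With \<open>(z1, w1)\<close> fixed,
  the kernel is the value at \<open>(z, w)\<close> of a single Laurent polynomial, which can be
  compared with a reproducing element.\<close>

lemma vkernel_sum:
  "vkernel (vec (k + 1) (\<lambda>i. b (k - i))) z w z1 w1
    = leval (\<Sum>l\<le>k. lscale (cnj (leval (b l) z1 w1)) (b l)) z w"
proof -
  have "vkernel (vec (k + 1) (\<lambda>i. b (k - i))) z w z1 w1
      = (\<Sum>i<Suc k. leval (b (Suc k - Suc i)) z w * cnj (leval (b (Suc k - Suc i)) z1 w1))"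
    by (simp add: vkernel_def veval_def scalar_prod_def atLeast0LessThan)
  also have "\<dots> = (\<Sum>i<Suc k. leval (b i) z w * cnj (leval (b i) z1 w1))"
    by (rule sum.nat_diff_reindex)
  finally show ?thesis
    by (simp add: leval_sum leval_lscale lessThan_Suc_atMost mult.commute)
qed

section \<open>Reversal\<close>

text \<open>For \<open>k = (n, m)\<close> this is the map that \<open>Phi_rev\<close> applies to
  each entry; it is a conjugate-linear involution.\<close>

definition lrev :: "int \<times> int \<Rightarrow> laurent \<Rightarrow> laurent" where
  "lrev k p = mono2 k * lstar p"

lemma lrev_add: "lrev k (p + q) = lrev k p + lrev k q"
  by (simp add: lrev_def lstar_add distrib_left)

lemma lrev_lscale: "lrev k (lscale c p) = lscale (cnj c) (lrev k p)"
  by (simp add: lrev_def lstar_lscale lscale_mult_right)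

lemma lrev_lrev [simp]: "lrev k (lrev k p) = p"
  by (simp add: lrev_def lstar_mult lstar_mono2 mono2_mult mono2_zero flip: mult.assoc)

lemma lrev_mono2: "lrev k (mono2 i) = mono2 (k - i)"
  by (simp add: lrev_def lstar_mono2 mono2_mult)

lemma lrev_zero: "lrev k 0 = 0"
  by (metis add_cancel_right_left lrev_add)

text \<open>Preimages of subspaces under a conjugate-linear map are subspaces, so it suffices to
  check generators.\<close>

lemma lrev_in_span: "p \<in> laurent.span S \<Longrightarrow> lrev k p \<in> laurent.span (lrev k ` S)"
proof (induction rule: laurent.span_induct)
  case base
  then show ?case
    by (auto simp: laurent.subspace_def lrev_add lrev_lscale lrev_zero laurent.span_zero
        intro: laurent.span_add laurent.span_scale)
qed (auto intro: laurent.span_base)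

lemma lrev_in_Pol:
  assumes "p \<in> Pol I" "\<And>i. i \<in> I \<Longrightarrow> k - i \<in> J"
  shows "lrev k p \<in> Pol J"
  using lrev_in_span[OF assms(1), of k] assms(2)
  by (auto simp: image_image lrev_mono2 intro: laurent.span_mono[THEN subsetD, rotated])


section \<open>Positive definite functionals\<close>

text \<open>Half-open ranges make the box empty at \<open>n = 0\<close> or \<open>m = 0\<close>,
  which is where the construction of reproducing elements starts; \<open>LPi_hat n m\<close> belongs
  to the box with both sizes raised by one.\<close>

definition box :: "nat \<Rightarrow> nat \<Rightarrow> (int \<times> int) set" where
  "box n m = {0..<int n} \<times> {0..<int m}"

lemma finite_box: "finite (box n m)"
  by (simp add: box_def)

lemma box_mono: "n \<le> n' \<Longrightarrow> m \<le> m' \<Longrightarrow> box n m \<subseteq> box n' m'"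
  by (auto simp: box_def)

lemma LPi_hat_eq: "LPi_hat n m = Pol (box (n + 1) (m + 1))"
  unfolding LPi_hat_def box_def by (rule arg_cong[where f = "\<lambda>I. Pol I"]) auto

lemma pair_int_image:
  "(\<lambda>j. (a, int j)) ` {..n} = {a} \<times> {0..int n}"
  "(\<lambda>i. (int i, a)) ` {..n} = {0..int n} \<times> {a}"
proof -
  have "int ` {..n} = {0..int n}"
    using image_int_atLeastAtMost[of 0 n] by (simp add: atLeast0AtMost)
  from this[symmetric]
  show "(\<lambda>j. (a, int j)) ` {..n} = {a} \<times> {0..int n}"
    and "(\<lambda>i. (int i, a)) ` {..n} = {0..int n} \<times> {a}"
    by auto
qed

lemma box_Suc_left: "box (n + 1) (m + 1) = box n (m + 1) \<union> (\<lambda>j. (int n, int j)) ` {..m}"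
  by (auto simp: box_def pair_int_image)

lemma box_Suc_right: "box (n + 1) (m + 1) = box (n + 1) m \<union> (\<lambda>i. (int i, int m)) ` {..n}"
  by (auto simp: box_def pair_int_image)

lemma inj_disjoint_left:
  "inj_on (\<lambda>j. (int n, int j)) A" "(\<lambda>j. (int n, int j)) ` A \<inter> box n m = {}"
  by (auto simp: inj_on_def box_def)

lemma inj_disjoint_right:
  "inj_on (\<lambda>i. (int i, int m)) A" "(\<lambda>i. (int i, int m)) ` A \<inter> box n m = {}"
  by (auto simp: inj_on_def box_def)

text \<open>Linearity and symmetry are global, so the algebra of \<open>linner\<close> carries no
  membership conditions; only positivity is tied to \<open>LPi_hat N M\<close>.\<close>

locale laurent_inner =
  fixes L :: "laurent \<Rightarrow> complex" and N M :: nat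
  assumes L_add: "L (p + q) = L p + L q"
    and L_lscale: "L (lscale c p) = c * L p"
    and L_lstar: "L (lstar p) = cnj (L p)"
    and L_pos: "p \<in> LPi_hat N M \<Longrightarrow> p \<noteq> 0 \<Longrightarrow> 0 < linner L p p"
begin

lemma linner_add_left: "linner L (p + q) r = linner L p r + linner L q r"
  by (simp add: linner_def distrib_right L_add)

lemma linner_lscale_left: "linner L (lscale c p) q = c * linner L p q"
  by (simp add: linner_def lscale_mult_left L_lscale)

lemma linner_cnj: "linner L q p = cnj (linner L p q)"
  by (simp add: linner_def lstar_mult mult.commute flip: L_lstar)

lemma linner_add_right: "linner L r (p + q) = linner L r p + linner L r q"
  by (simp add: linner_def lstar_add distrib_left L_add)

lemma linner_lscale_right: "linner L p (lscale c q) = cnj c * linner L p q"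
  by (simp add: linner_def lstar_lscale lscale_mult_right L_lscale)

lemma linner_zero_left: "linner L 0 p = 0"
  using linner_add_left[of 0 0 p] by simp

lemma linner_zero_right: "linner L p 0 = 0"
  using linner_add_right[of p 0 0] by simp

lemma linner_diff_left: "linner L (p - q) r = linner L p r - linner L q r"
  using linner_add_left[of "p - q" q r] by simp

lemma linner_diff_right: "linner L r (p - q) = linner L r p - linner L r q"
  using linner_add_right[of r "p - q" q] by simp

lemma linner_sum_right: "linner L p (sum f A) = (\<Sum>a\<in>A. linner L p (f a))"
  by (induction A rule: infinite_finite_induct) (auto simp: linner_add_right linner_zero_right)

text \<open>A monomial cancels against its own \<open>lstar\<close>: the Toeplitz structure of the
  inner product.\<close>

lemma linner_mono2_mult: "linner L (mono2 k * p) (mono2 k * q) = linner L p q"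
proof -
  have "mono2 k * p * (mono2 (- k) * lstar q) = mono2 k * mono2 (- k) * (p * lstar q)"
    by (simp only: ac_simps)
  then show ?thesis
    by (simp add: linner_def lstar_mult lstar_mono2 mono2_mult mono2_zero)
qed

text \<open>The monomial factor cancels, and \<open>lstar\<close> on both sides swaps the arguments:
  reversal is antiunitary.\<close>

lemma linner_lrev: "linner L (lrev k p) (lrev k q) = linner L q p"
  unfolding lrev_def linner_mono2_mult by (simp add: linner_def mult.commute)

section \<open>Orthogonal projection; existence and uniqueness of orthonormal polynomials\<close>

lemma linner_span_right:
  assumes "q \<in> laurent.span S" "\<And>s. s \<in> S \<Longrightarrow> linner L p s = 0"
  shows "linner L p q = 0"
  using assms(1)
  by (induction rule: laurent.span_induct)
    (auto simp: assms(2) laurent.subspace_def linner_add_right linner_zero_right linner_lscale_right)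

lemma linner_eq_0D:
  assumes "I \<subseteq> box (N + 1) (M + 1)" "p \<in> Pol I" "linner L p p = 0"
  shows "p = 0"
  using L_pos[of p] Pol_mono[OF assms(1,2)] assms(3) by (auto simp: LPi_hat_eq)

text \<open>One Gram-Schmidt step per exponent: both \<open>x\<close> and the new monomial are
  projected onto the smaller span, and the projection of \<open>x\<close> is then corrected along
  the residual of the new monomial.\<close>

lemma projection_exists:
  assumes "finite I" "I \<subseteq> box (N + 1) (M + 1)"
  shows "\<exists>p\<in>Pol I. \<forall>k\<in>I. linner L (x - p) (mono2 k) = 0"
  using assms
proof (induction I arbitrary: x rule: finite_induct)
  case empty
  then show ?case by simp
next
  case (insert e I)
  then have I: "I \<subseteq> box (N + 1) (M + 1)" by simp
  from insert.IH[OF I] obtain p where p: "p \<in> Pol I" "\<And>k. k \<in> I \<Longrightarrow> linner L (x - p) (mono2 k) = 0"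
    by blast
  from insert.IH[OF I] obtain q
    where q: "q \<in> Pol I" "\<And>k. k \<in> I \<Longrightarrow> linner L (mono2 e - q) (mono2 k) = 0"
    by blast
  define r where "r = mono2 e - q"
  \<comment> \<open>\<open>q\<close> has no term at \<open>e\<close>, so \<open>r\<close> is nonzero
    and one may divide by its squared norm.\<close>
  have "coef r e = 1"
    using q(1) insert.hyps by (auto simp: r_def lookup_minus coef_mono2 span_mono2 in_keys_iff)
  then have "r \<noteq> 0" by auto
  have r_Pol: "r \<in> Pol (insert e I)"
    unfolding r_def by (intro laurent.span_diff mono2_in_Pol Pol_mono[OF _ q(1)]) auto
  \<comment> \<open>\<open>c\<close> is the component of \<open>x - p\<close> along
    \<open>r\<close>. Subtracting it gives orthogonality to \<open>r\<close> and keeps that to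
    \<open>I\<close>, since \<open>r\<close> is itself orthogonal to \<open>I\<close>.\<close>
  define c where "c = linner L (x - p) r / linner L r r"
  define p' where "p' = p + lscale c r"
  have rr: "linner L r r \<noteq> 0"
    using linner_eq_0D[OF insert.prems r_Pol] \<open>r \<noteq> 0\<close> by blast
  have x_p': "linner L (x - p') s = linner L (x - p) s - c * linner L r s" for s
    by (simp add: p'_def linner_diff_left linner_add_left linner_lscale_left)
  have orth_I: "linner L (x - p') (mono2 k) = 0" if "k \<in> I" for k
    using p(2)[OF that] q(2)[OF that] by (simp add: x_p' flip: r_def)
  have "linner L (x - p') r = 0"
    using rr by (simp add: x_p' c_def)
  moreover have "linner L (x - p') q = 0"
    using q(1) orth_I by (auto intro: linner_span_right)
  \<comment> \<open>\<open>r + q\<close> is the new monomial.\<close>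
  ultimately have "linner L (x - p') (r + q) = 0"
    by (simp add: linner_add_right)
  then have "linner L (x - p') (mono2 e) = 0" by (simp add: r_def)
  moreover have "p' \<in> Pol (insert e I)"
    unfolding p'_def by (intro laurent.span_add laurent.span_scale r_Pol Pol_mono[OF _ p(1)]) auto
  ultimately show ?case using orth_I by auto
qed

text \<open>Subtracting from the monomial at \<open>e\<close> its projection onto the others leaves
  coefficient 1 at \<open>e\<close>; dividing by the norm keeps that coefficient positive.\<close>

lemma orthonormal_poly_exists:
  assumes "finite I" "I \<subseteq> box (N + 1) (M + 1)" "e \<in> I"
  shows "\<exists>p. is_orthonormal_poly L I e p"
proof -
  obtain q where q: "q \<in> Pol (I - {e})"
      "\<And>k. k \<in> I - {e} \<Longrightarrow> linner L (mono2 e - q) (mono2 k) = 0"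
    using projection_exists[of "I - {e}" "mono2 e"] assms by blast
  define r where "r = mono2 e - q"
  have coef_r: "coef r e = 1"
    using q(1) by (auto simp: r_def lookup_minus coef_mono2 span_mono2 in_keys_iff)
  then have "r \<noteq> 0" by auto
  have r_Pol: "r \<in> Pol I"
    unfolding r_def using assms(3) by (intro laurent.span_diff mono2_in_Pol Pol_mono[OF _ q(1)]) auto
  have pos: "0 < linner L r r"
    using L_pos[of r] \<open>r \<noteq> 0\<close> Pol_mono[OF assms(2) r_Pol] by (simp add: LPi_hat_eq)
  \<comment> \<open>A positive element in the order on \<open>complex\<close> is real, so the norm
    is a real square root.\<close>
  define s where "s = Re (linner L r r)"
  have s: "linner L r r = complex_of_real s" "0 < s"
    using pos by (auto simp: s_def less_complex_def complex_eq_iff)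
  define p where "p = lscale (complex_of_real (1 / sqrt s)) r"
  have "is_orthonormal_poly L I e p"
    unfolding is_orthonormal_poly_def
  proof (intro conjI ballI)
    show "p \<in> Pol I"
      unfolding p_def by (intro laurent.span_scale r_Pol)
    show "0 < coef p e"
      using s(2) by (simp add: p_def coef_r less_complex_def)
    have "linner L p p = complex_of_real (1 / sqrt s * (1 / sqrt s) * s)"
      by (simp add: p_def linner_lscale_left linner_lscale_right s(1) del: real_sqrt_mult_self)
    also have "1 / sqrt s * (1 / sqrt s) * s = 1"
      using s(2) by simp
    finally show "linner L p p = 1" by simp
    show "linner L p (mono2 k) = 0" if "k \<in> I - {e}" for k
      using q(2)[OF that] by (simp add: p_def linner_lscale_left flip: r_def)
  qed
  then show ?thesis by blast
qed

text \<open>Weighting each polynomial with the leading coefficient of the other cancels the term at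
  \<open>e\<close>. The difference then lies in the span it is orthogonal to, so it vanishes; equal
  norms and positive leading coefficients turn proportionality into equality.\<close>

lemma orthonormal_poly_unique:
  assumes I: "I \<subseteq> box (N + 1) (M + 1)"
    and p: "is_orthonormal_poly L I e p" and q: "is_orthonormal_poly L I e q"
  shows "p = q"
proof -
  define d where "d = lscale (coef q e) p - lscale (coef p e) q"
  have "d \<in> Pol I"
    using p q unfolding d_def is_orthonormal_poly_def
    by (intro laurent.span_diff laurent.span_scale) auto
  moreover have "coef d e = 0" by (simp add: d_def lookup_minus)
  ultimately have d: "d \<in> Pol (I - {e})" by (auto simp: span_mono2 in_keys_iff)
  have "linner L d d = 0"
    using d
  proof (rule linner_span_right)
    fix s assume "s \<in> mono2 ` (I - {e})"
    then obtain k where "k \<in> I - {e}" "s = mono2 k" by blast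
    with p q show "linner L d s = 0"
      by (simp add: d_def is_orthonormal_poly_def linner_diff_left linner_lscale_left)
  qed
  with d I have "d = 0" by (intro linner_eq_0D[of "I - {e}"]) auto
  then have eq: "lscale (coef q e) p = lscale (coef p e) q" by (simp add: d_def)
  have "linner L (lscale (coef q e) p) (lscale (coef q e) p) =
        linner L (lscale (coef p e) q) (lscale (coef p e) q)"
    by (simp only: eq)
  then have norms: "coef q e * cnj (coef q e) = coef p e * cnj (coef p e)"
    using p q by (simp add: linner_lscale_left linner_lscale_right is_orthonormal_poly_def mult.commute)
  obtain a b where ab: "coef p e = complex_of_real a" "0 < a" "coef q e = complex_of_real b" "0 < b"
    using p q by (metis complex_is_Real_iff less_complex_def of_real_Re is_orthonormal_poly_def zero_complex.simps)
  have "b * b = a * a"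
    using norms unfolding ab complex_cnj_complex_of_real by (simp only: of_real_mult[symmetric] of_real_eq_iff)
  then have "a = b"
    using ab by (metis abs_of_pos abs_mult_self_eq real_sqrt_mult_self real_sqrt_abs2)
  then show ?thesis using eq ab by simp
qed

section \<open>Reproducing kernels\<close>

text \<open>\<open>f\<close> is the Riesz representer of evaluation at \<open>(z, w)\<close>, that
  is, the reproducing kernel with its second point fixed.\<close>

definition reproducing :: "(int \<times> int) set \<Rightarrow> complex \<Rightarrow> complex \<Rightarrow> laurent \<Rightarrow> bool" where
  "reproducing I z w f \<longleftrightarrow> f \<in> Pol I \<and> (\<forall>p\<in>Pol I. linner L p f = leval p z w)"

lemma reproducing_unique:
  assumes I: "I \<subseteq> box (N + 1) (M + 1)" and f: "reproducing I z w f" and g: "reproducing I z w g"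
  shows "f = g"
proof -
  have "f - g \<in> Pol I"
    using f g by (auto simp: reproducing_def intro: laurent.span_diff)
  moreover from this have "linner L (f - g) (f - g) = 0"
    using f g by (subst linner_diff_right) (auto simp: reproducing_def)
  ultimately have "f - g = 0" using I by (intro linner_eq_0D)
  then show ?thesis by simp
qed

text \<open>\<open>Pol J'\<close> is the orthogonal sum of \<open>Pol J\<close> and the span of the
  \<open>b l\<close>, and the added sum represents evaluation on the second summand. By linearity
  the identity is checked on generators only.\<close>

lemma reproducing_extend:
  assumes f: "reproducing J z w f" and J: "J \<subseteq> J'" and fin: "finite A"
    and b: "\<And>l. l \<in> A \<Longrightarrow> b l \<in> Pol J'"
    and orthonormal: "\<And>k l. k \<in> A \<Longrightarrow> l \<in> A \<Longrightarrow> linner L (b k) (b l) = (if k = l then 1 else 0)"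
    and orth: "\<And>p l. p \<in> Pol J \<Longrightarrow> l \<in> A \<Longrightarrow> linner L p (b l) = 0"
    and spanning: "Pol J' \<subseteq> laurent.span (Pol J \<union> b ` A)"
  shows "reproducing J' z w (f + (\<Sum>l\<in>A. lscale (cnj (leval (b l) z w)) (b l)))"
    (is "reproducing _ _ _ ?g")
  unfolding reproducing_def
proof (intro conjI ballI)
  show "?g \<in> Pol J'"
    using f Pol_mono[OF J, of f] b
    by (intro laurent.span_add laurent.span_sum laurent.span_scale) (auto simp: reproducing_def)
  fix p assume "p \<in> Pol J'"
  then have "p \<in> laurent.span (Pol J \<union> b ` A)" using spanning by blast
  then show "linner L p ?g = leval p z w"
  proof (induction rule: laurent.span_induct)
    case base
    show ?case
      by (auto simp: laurent.subspace_def linner_zero_left leval_zero linner_add_left leval_add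
          linner_lscale_left leval_lscale)
  next
    case (step p)
    then consider "p \<in> Pol J" | k where "k \<in> A" "p = b k" by auto
    then show ?case
    proof cases
      case 1
      then show ?thesis
        using f orth by (simp add: linner_add_right linner_sum_right linner_lscale_right reproducing_def)
    next
      case 2
      have "linner L (b k) f = cnj (linner L f (b k))" by (rule linner_cnj)
      also have "\<dots> = 0" using orth 2 f by (simp add: reproducing_def)
      finally show ?thesis
        using 2 fin
        by (simp add: linner_add_right linner_sum_right linner_lscale_right orthonormal if_distrib
            sum.delta' cong: if_cong)
    qed
  qed
qed

text \<open>\<open>e\<close> lists the new exponents in order, and the \<open>b l\<close> are the
  Gram-Schmidt vectors for \<open>J\<close> followed by this list. Each is orthogonal to all that
  precedes it, and its nonzero leading coefficient allows the monomials to be recovered.\<close>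

lemma
  fixes k :: nat
  assumes b: "\<And>l. l \<le> k \<Longrightarrow> is_orthonormal_poly L (J \<union> e ` {..l}) (e l) (b l)"
    and inj: "inj_on e {..k}" and disj: "e ` {..k} \<inter> J = {}"
  shows chain_in_Pol: "\<And>l. l \<le> k \<Longrightarrow> b l \<in> Pol (J \<union> e ` {..k})"
    and chain_orthonormal:
      "\<And>i l. i \<le> k \<Longrightarrow> l \<le> k \<Longrightarrow> linner L (b i) (b l) = (if i = l then 1 else 0)"
    and chain_orth: "\<And>p l. p \<in> Pol J \<Longrightarrow> l \<le> k \<Longrightarrow> linner L p (b l) = 0"
    and chain_spanning: "Pol (J \<union> e ` {..k}) \<subseteq> laurent.span (Pol J \<union> b ` {..k})"
proof -
  have b_Pol: "b l \<in> Pol (J \<union> e ` {..l})" if "l \<le> k" for l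
    using b[OF that] by (simp add: is_orthonormal_poly_def)
  have b_orth: "linner L (b l) p = 0" if "l \<le> k" "p \<in> Pol (J \<union> e ` {..<l})" for l p
    using that(2)
  proof (rule linner_span_right)
    fix s assume "s \<in> mono2 ` (J \<union> e ` {..<l})"
    then obtain i where i: "s = mono2 i" "i \<in> J \<union> e ` {..<l}" by blast
    \<comment> \<open>Orthogonality of \<open>b l\<close> is given only away from
      \<open>e l\<close>; disjointness and injectivity exclude that \<open>e l\<close> occurred
      earlier.\<close>
    have "i \<noteq> e l"
    proof
      assume "i = e l"
      with i(2) disj that(1) obtain j where "j < l" "e j = e l" by auto
      with inj_onD[OF inj, of j l] that(1) show False by fastforce
    qed
    with i b[OF that(1)] show "linner L (b l) s = 0"
      by (auto simp: is_orthonormal_poly_def)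
  qed
  show "b l \<in> Pol (J \<union> e ` {..k})" if "l \<le> k" for l
    using b_Pol[OF that] by (rule Pol_mono[rotated]) (use that in auto)
  have less: "linner L (b l) (b i) = 0" if "i < l" "l \<le> k" for i l
    using that by (intro b_orth Pol_mono[OF _ b_Pol[of i]]) auto
  show "linner L (b i) (b l) = (if i = l then 1 else 0)" if "i \<le> k" "l \<le> k" for i l
    using b[of i] less[of i l] less[of l i] linner_cnj[of "b i" "b l"] that
    by (cases i l rule: linorder_cases) (auto simp: is_orthonormal_poly_def)
  show "linner L p (b l) = 0" if "p \<in> Pol J" "l \<le> k" for p l
    using linner_cnj[of p "b l"] b_orth[OF that(2) Pol_mono[OF _ that(1)]] by auto
  let ?S = "laurent.span (Pol J \<union> b ` {..k})"
  have e_in: "mono2 (e l) \<in> ?S" if "l \<le> k" for l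
    using that
  proof (induction l rule: less_induct)
    case (less l)
    define c where "c = coef (b l) (e l)"
    have "c \<noteq> 0" using b[OF less.prems] by (auto simp: c_def is_orthonormal_poly_def)
    \<comment> \<open>Without its leading term, \<open>b l\<close> involves only \<open>J\<close>
      and earlier exponents, which the induction hypothesis covers.\<close>
    define r where "r = b l - lscale c (mono2 (e l))"
    have "Poly_Mapping.keys r \<subseteq> J \<union> e ` {..l}"
      using laurent.span_diff[OF b_Pol[OF less.prems] laurent.span_scale[OF mono2_in_Pol[of "e l"]]]
      by (auto simp: r_def span_mono2)
    moreover have "coef r (e l) = 0" by (simp add: r_def c_def lookup_minus coef_mono2)
    ultimately have "r \<in> Pol (J \<union> e ` {..<l})"
      unfolding span_mono2 using not_in_keys_iff_lookup_eq_zero[of "e l" r]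
      by (auto dest!: subsetD simp: le_less simp del: split_paired_All)
    moreover have "Pol (J \<union> e ` {..<l}) \<subseteq> ?S"
    proof (rule laurent.span_minimal)
      show "mono2 ` (J \<union> e ` {..<l}) \<subseteq> ?S"
        using less by (auto intro: laurent.span_base mono2_in_Pol)
    qed (rule laurent.subspace_span)
    ultimately have "r \<in> ?S" by blast
    then have "lscale (1 / c) (b l - r) \<in> ?S"
      using less.prems by (intro laurent.span_scale laurent.span_diff) (auto intro: laurent.span_base)
    then show ?case using \<open>c \<noteq> 0\<close> by (simp add: r_def)
  qed
  show "Pol (J \<union> e ` {..k}) \<subseteq> ?S"
  proof (rule laurent.span_minimal)
    show "mono2 ` (J \<union> e ` {..k}) \<subseteq> ?S"
      using e_in by (auto intro: laurent.span_base mono2_in_Pol)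
  qed (rule laurent.subspace_span)
qed

lemma chain_kernel:
  fixes k :: nat
  assumes "reproducing J z w f"
    and "\<And>l. l \<le> k \<Longrightarrow> is_orthonormal_poly L (J \<union> e ` {..l}) (e l) (b l)"
    and "inj_on e {..k}" "e ` {..k} \<inter> J = {}"
  shows "reproducing (J \<union> e ` {..k}) z w (f + (\<Sum>l\<le>k. lscale (cnj (leval (b l) z w)) (b l)))"
  by (rule reproducing_extend[OF assms(1) _ finite_atMost])
    (use chain_in_Pol[OF assms(2-4)] chain_orthonormal[OF assms(2-4)] chain_orth[OF assms(2-4)]
      chain_spanning[OF assms(2-4)] in auto)

text \<open>It depends on the span alone and not on a basis, which makes the kernels of different
  orthonormal families comparable.\<close>

definition kernel :: "nat \<Rightarrow> nat \<Rightarrow> complex \<Rightarrow> complex \<Rightarrow> complex \<Rightarrow> complex \<Rightarrow> complex" where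
  "kernel n m z w z1 w1 = leval (THE f. reproducing (box n m) z1 w1 f) z w"

lemma kernel_eq:
  assumes "n \<le> N + 1" "m \<le> M + 1" "reproducing (box n m) z1 w1 f"
  shows "kernel n m z w z1 w1 = leval f z w"
proof -
  have "(THE f. reproducing (box n m) z1 w1 f) = f"
    using assms(3) reproducing_unique[OF box_mono[OF assms(1,2)] _ assms(3)] by (rule the_equality)
  then show ?thesis by (simp add: kernel_def)
qed

section \<open>Reproducing elements built from \<open>phi\<close> and
  \<open>phi_tilde\<close>\<close>

lemma orthonormal_poly_the:
  assumes "I \<subseteq> box (N + 1) (M + 1)" "e \<in> I"
  shows "is_orthonormal_poly L I e (THE p. is_orthonormal_poly L I e p)"
  using orthonormal_poly_exists[OF finite_subset[OF assms(1) finite_box] assms]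
    orthonormal_poly_unique[OF assms(1)] by (metis theI')

text \<open>The defining exponent set is brought into the form of the chain lemmas: a box followed
  by an initial segment of the next column.\<close>

lemma phi_orthonormal:
  assumes "n \<le> N" "m \<le> M" "l \<le> m"
  shows "is_orthonormal_poly L (box n (m + 1) \<union> (\<lambda>j. (int n, int j)) ` {..l}) (int n, int l)
    (phi L n m l)"
proof -
  have eq: "{(i, j). 0 \<le> i \<and> i < int n \<and> 0 \<le> j \<and> j \<le> int m} \<union> {(int n, j) |j. 0 \<le> j \<and> j \<le> int l}
      = box n (m + 1) \<union> (\<lambda>j. (int n, int j)) ` {..l}"
    by (auto simp: box_def pair_int_image)
  show ?thesis
    unfolding phi_def eq using assms by (intro orthonormal_poly_the) (auto simp: box_def pair_int_image)
qed

lemma phi_tilde_orthonormal: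
  assumes "n \<le> N" "m \<le> M" "l \<le> n"
  shows "is_orthonormal_poly L (box (n + 1) m \<union> (\<lambda>i. (int i, int m)) ` {..l}) (int l, int m)
    (phi_tilde L n m l)"
proof -
  have eq: "{(i, j). 0 \<le> i \<and> i \<le> int n \<and> 0 \<le> j \<and> j < int m} \<union> {(i, int m) |i. 0 \<le> i \<and> i \<le> int l}
      = box (n + 1) m \<union> (\<lambda>i. (int i, int m)) ` {..l}"
    by (auto simp: box_def pair_int_image)
  show ?thesis
    unfolding phi_tilde_def eq using assms by (intro orthonormal_poly_the) (auto simp: box_def pair_int_image)
qed

lemma reproducing_phi:
  assumes "n \<le> N" "m \<le> M" "reproducing (box n (m + 1)) z w f"
  shows "reproducing (box (n + 1) (m + 1)) z w
    (f + (\<Sum>l\<le>m. lscale (cnj (leval (phi L n m l) z w)) (phi L n m l)))"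
  unfolding box_Suc_left
  by (rule chain_kernel[OF assms(3) phi_orthonormal[OF assms(1,2)] inj_disjoint_left])

lemma reproducing_phi_tilde:
  assumes "n \<le> N" "m \<le> M" "reproducing (box (n + 1) m) z w f"
  shows "reproducing (box (n + 1) (m + 1)) z w
    (f + (\<Sum>l\<le>n. lscale (cnj (leval (phi_tilde L n m l) z w)) (phi_tilde L n m l)))"
  unfolding box_Suc_right
  by (rule chain_kernel[OF assms(3) phi_tilde_orthonormal[OF assms(1,2)] inj_disjoint_right])

text \<open>Starting from the empty box, represented by 0, each step adds one column by means of
  \<open>phi\<close>. The case \<open>m = 0\<close> is separate because a column
  \<open>phi L n m'\<close> belongs to height \<open>m' + 1\<close>.\<close>

lemma reproducing_exists:
  assumes "n \<le> N + 1" "m \<le> M + 1"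
  shows "\<exists>f. reproducing (box n m) z w f"
proof -
  have empty: "reproducing {} z w 0"
    by (simp add: reproducing_def linner_zero_left leval_zero)
  show ?thesis
  proof (cases m)
    case 0
    then show ?thesis using empty by (auto simp: box_def)
  next
    case (Suc m')
    show ?thesis
      using assms(1)
    proof (induction n)
      case 0
      show ?case using empty by (auto simp: box_def)
    next
      case (Suc n)
      then show ?case
        using reproducing_phi[of n m'] \<open>m = Suc m'\<close> assms(2) by auto
    qed
  qed
qed

text \<open>Multiplication by \<open>z\<close> is an isometry, and evaluating a multiple of
  \<open>z\<close> yields an extra factor \<open>z\<close>, which enters the second argument
  conjugated.\<close>

lemma reproducing_z_mult:
  assumes f: "reproducing (box n m) z w f"
  shows "reproducing ({1..<int n + 1} \<times> {0..<int m}) z w (lscale (cnj z) (mono2 (1, 0) * f))"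
  unfolding reproducing_def
proof (intro conjI ballI)
  let ?J = "{1..<int n + 1} \<times> {0..<int m}"
  have "mono2 (1, 0) * f \<in> Pol ?J"
    using f by (intro mono2_mult_in_Pol[of f "box n m"]) (auto simp: reproducing_def box_def)
  then show "lscale (cnj z) (mono2 (1, 0) * f) \<in> Pol ?J"
    by (rule laurent.span_scale)
  fix p assume p: "p \<in> Pol ?J"
  \<comment> \<open>All exponents of \<open>z\<close> in \<open>p\<close> are at least 1, so
    \<open>p\<close> can be divided by \<open>z\<close>.\<close>
  define q where "q = mono2 (- 1, 0) * p"
  have q: "q \<in> Pol (box n m)"
    unfolding q_def using p by (rule mono2_mult_in_Pol) (auto simp: box_def)
  have p_eq: "p = mono2 (1, 0) * q"
    by (simp add: q_def mono2_mult mono2_zero flip: mult.assoc zero_prod_def)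
  have "linner L p (lscale (cnj z) (mono2 (1, 0) * f)) = z * leval q z w"
    using f q by (simp add: p_eq linner_lscale_right linner_mono2_mult reproducing_def)
  also have "\<dots> = leval p z w"
    unfolding p_eq by (rule leval_z_mult[OF q, symmetric]) (auto simp: box_def)
  finally show "linner L p (lscale (cnj z) (mono2 (1, 0) * f)) = leval p z w" .
qed

text \<open>Reversal preserves the large box and carries the span of the smaller one onto its
  multiple by \<open>z\<close>. Being antiunitary, it sends the \<open>phi\<close> to an orthonormal
  basis of the complement of that multiple.\<close>

lemma reproducing_rev:
  assumes "n \<le> N" "m \<le> M" "reproducing (box n (m + 1)) z w f"
  defines "\<psi> \<equiv> \<lambda>l. lrev (int n, int m) (phi L n m l)"
  shows "reproducing (box (n + 1) (m + 1)) z w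
    (lscale (cnj z) (mono2 (1, 0) * f) + (\<Sum>l\<le>m. lscale (cnj (leval (\<psi> l) z w)) (\<psi> l)))"
proof (rule reproducing_extend[OF reproducing_z_mult[OF assms(3)]])
  let ?k = "(int n, int m)" and ?J = "{1..<int n + 1} \<times> {0..<int (m + 1)}"
  note chain = phi_orthonormal[OF assms(1,2)] inj_disjoint_left
  have phi_Pol: "phi L n m l \<in> Pol (box (n + 1) (m + 1))" if "l \<le> m" for l
    using chain_in_Pol[where k = m, OF chain] that unfolding box_Suc_left by blast
  have phi_ortho: "linner L (phi L n m i) (phi L n m l) = (if i = l then 1 else 0)"
    if "i \<le> m" "l \<le> m" for i l
    using chain_orthonormal[where k = m, OF chain] that by blast
  have phi_orth: "linner L p (phi L n m l) = 0" if "p \<in> Pol (box n (m + 1))" "l \<le> m" for p l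
    using chain_orth[where k = m, OF chain] that by blast
  have phi_span: "Pol (box (n + 1) (m + 1)) \<subseteq> laurent.span (Pol (box n (m + 1)) \<union> phi L n m ` {..m})"
    using chain_spanning[where k = m, OF chain] unfolding box_Suc_left by blast
  have rev_box: "lrev ?k p \<in> Pol (box (n + 1) (m + 1))" if "p \<in> Pol (box (n + 1) (m + 1))" for p
    using that by (rule lrev_in_Pol) (auto simp: box_def)
  have rev_J: "lrev ?k p \<in> Pol ?J" if "p \<in> Pol (box n (m + 1))" for p
    using that by (rule lrev_in_Pol) (auto simp: box_def)
  show "?J \<subseteq> box (n + 1) (m + 1)"
    by (auto simp: box_def)
  show "\<psi> l \<in> Pol (box (n + 1) (m + 1))" if "l \<in> {..m}" for l
    unfolding \<psi>_def using that by (intro rev_box phi_Pol) simp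
  show "linner L (\<psi> i) (\<psi> l) = (if i = l then 1 else 0)" if "i \<in> {..m}" "l \<in> {..m}" for i l
    using phi_ortho that by (auto simp: \<psi>_def linner_lrev)
  show "linner L p (\<psi> l) = 0" if "p \<in> Pol ?J" "l \<in> {..m}" for p l
  proof -
    have "lrev ?k p \<in> Pol (box n (m + 1))"
      using that(1) by (rule lrev_in_Pol) (auto simp: box_def)
    then have "linner L (lrev ?k p) (phi L n m l) = 0"
      using phi_orth that(2) by simp
    moreover have "linner L p (\<psi> l) = linner L (phi L n m l) (lrev ?k p)"
      using linner_lrev[of ?k "lrev ?k p" "phi L n m l"] by (simp add: \<psi>_def)
    ultimately show ?thesis
      using linner_cnj[of "lrev ?k p" "phi L n m l"] by simp
  qed
  show "Pol (box (n + 1) (m + 1)) \<subseteq> laurent.span (Pol ?J \<union> \<psi> ` {..m})"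
  proof
    fix p assume "p \<in> Pol (box (n + 1) (m + 1))"
    \<comment> \<open>The reversed polynomial is expanded first; reversing the expansion gives one
      for \<open>p\<close>.\<close>
    then have "lrev ?k p \<in> laurent.span (Pol (box n (m + 1)) \<union> phi L n m ` {..m})"
      using rev_box phi_span by blast
    from lrev_in_span[OF this, of ?k]
    have "p \<in> laurent.span (lrev ?k ` (Pol (box n (m + 1)) \<union> phi L n m ` {..m}))"
      by simp
    moreover have "lrev ?k ` (Pol (box n (m + 1)) \<union> phi L n m ` {..m}) \<subseteq> Pol ?J \<union> \<psi> ` {..m}"
      using rev_J by (auto simp: \<psi>_def)
    ultimately show "p \<in> laurent.span (Pol ?J \<union> \<psi> ` {..m})"
      using laurent.span_mono by blast
  qed
qed simp

section \<open>Vector kernels expressed through \<open>kernel\<close>\<close>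

lemma vkernel_Phi:
  assumes "n \<le> N" "m \<le> M"
  shows "vkernel (Phi L n m) z w z1 w1
    = kernel (n + 1) (m + 1) z w z1 w1 - kernel n (m + 1) z w z1 w1"
proof -
  obtain f where f: "reproducing (box n (m + 1)) z1 w1 f"
    using reproducing_exists[of n "m + 1"] assms by auto
  show ?thesis
    unfolding Phi_def vkernel_sum
    using kernel_eq[OF _ _ f] kernel_eq[OF _ _ reproducing_phi[OF assms f]] assms
    by (simp add: leval_add)
qed

lemma vkernel_Phi_tilde:
  assumes "n \<le> N" "m \<le> M"
  shows "vkernel (Phi_tilde L n m) z w z1 w1
    = kernel (n + 1) (m + 1) z w z1 w1 - kernel (n + 1) m z w z1 w1"
proof -
  obtain f where f: "reproducing (box (n + 1) m) z1 w1 f"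
    using reproducing_exists[of "n + 1" m] assms by auto
  show ?thesis
    unfolding Phi_tilde_def vkernel_sum
    using kernel_eq[OF _ _ f] kernel_eq[OF _ _ reproducing_phi_tilde[OF assms f]] assms
    by (simp add: leval_add)
qed

text \<open>In the subtracted term, \<open>cnj z1\<close> comes from the representer on the shifted
  box and \<open>z\<close> from evaluating its factor \<open>mono2 (1, 0)\<close>.\<close>

lemma vkernel_Phi_rev:
  assumes "n \<le> N" "m \<le> M"
  shows "vkernel (Phi_rev L n m) z w z1 w1
    = kernel (n + 1) (m + 1) z w z1 w1 - cnj z1 * z * kernel n (m + 1) z w z1 w1"
proof -
  obtain f where f: "reproducing (box n (m + 1)) z1 w1 f"
    using reproducing_exists[of n "m + 1"] assms by auto
  have eval: "leval (mono2 (1, 0) * f) z w = z * leval f z w"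
    using f by (intro leval_z_mult) (auto simp: reproducing_def box_def)
  have vec: "Phi_rev L n m = vec (m + 1) (\<lambda>i. lrev (int n, int m) (phi L n m (m - i)))"
    by (auto simp: Phi_rev_def Phi_def lrev_def)
  show ?thesis
    unfolding vec vkernel_sum[of m "\<lambda>l. lrev (int n, int m) (phi L n m l)"]
    using kernel_eq[OF _ _ f] kernel_eq[OF _ _ reproducing_rev[OF assms f]] assms
    by (simp add: leval_add leval_lscale eval)
qed

end

section \<open>Passage to a globally linear functional\<close>

lemma mult_lstar_in_LPi:
  assumes "p \<in> Pol (box (N + 1) (M + 1))" "q \<in> Pol (box (N + 1) (M + 1))"
  shows "p * lstar q \<in> LPi N M"
proof -
  \<comment> \<open>Exponents of \<open>p * lstar q\<close> are differences of exponents in the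
    box.\<close>
  have "a - b \<in> {(i, j). \<bar>i\<bar> \<le> int N \<and> \<bar>j\<bar> \<le> int M}"
    if "a \<in> box (N + 1) (M + 1)" "b \<in> box (N + 1) (M + 1)" for a b
    using that by (auto simp: box_def minus_prod_def)
  with assms keys_mult[of p "lstar q"] show ?thesis
    unfolding LPi_def span_mono2 keys_lstar by (fastforce simp del: split_paired_All)
qed

text \<open>A functional that is positive definite on \<open>LPi N M\<close> need not be linear outside that space,
  so it is first replaced by a linear Hermitian functional with the same values on it.\<close>

lemma laurent_inner_extension:
  assumes "positive_definite N M L"
  obtains L' where "laurent_inner L' N M" "\<And>p. p \<in> LPi N M \<Longrightarrow> L' p = L p"
proof
  define E where "E = {(i, j). \<bar>i\<bar> \<le> int N \<and> \<bar>j\<bar> \<le> int M}"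
  \<comment> \<open>Values on monomials in \<open>E\<close> are kept, and all other monomials are
    sent to 0.\<close>
  define L' where "L' p = (\<Sum>k\<in>E. coef p k * L (mono2 k))" for p
  have "E \<subseteq> {- int N..int N} \<times> {- int M..int M}" by (auto simp: E_def)
  then have fin: "finite E" by (rule finite_subset) simp
  have LPi: "LPi N M = Pol E" by (simp add: LPi_def E_def)
  have lin: "linear_functional N M L" and herm: "hermitian_functional N M L"
    and pos: "\<And>p. p \<in> LPi_hat N M \<Longrightarrow> p \<noteq> 0 \<Longrightarrow> 0 < linner L p p"
    using assms by (auto simp: positive_definite_def)
  show agree: "L' p = L p" if "p \<in> LPi N M" for p
  proof -
    have "L (lscale 0 0) = 0 * L 0"
      using lin laurent.span_zero[of "mono2 ` E"] unfolding linear_functional_def LPi by blast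
    then have "L 0 = 0" by simp
    \<comment> \<open>Membership in \<open>Pol E\<close> is carried through the induction because
      \<open>L\<close> is additive only there.\<close>
    have "L (\<Sum>k\<in>A. lscale (coef p k) (mono2 k)) = (\<Sum>k\<in>A. coef p k * L (mono2 k))
        \<and> (\<Sum>k\<in>A. lscale (coef p k) (mono2 k)) \<in> Pol E" if "A \<subseteq> E" for A
      using finite_subset[OF that fin] that
    proof (induction A rule: finite_induct)
      case (insert k A)
      have k: "mono2 k \<in> Pol E" using insert.prems by (auto intro: mono2_in_Pol)
      from this have "lscale (coef p k) (mono2 k) \<in> Pol E" by (rule laurent.span_scale)
      with k insert lin show ?case
        by (auto simp: linear_functional_def LPi laurent.span_add)
    qed (simp add: \<open>L 0 = 0\<close> laurent.span_zero)
    from this[OF order.refl] that fin show ?thesis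
      using laurent_expand[of E p] by (simp add: LPi span_mono2 L'_def)
  qed
  show "laurent_inner L' N M"
  proof
    show "L' (p + q) = L' p + L' q" for p q
      by (simp add: L'_def lookup_add algebra_simps sum.distrib)
    show "L' (lscale c p) = c * L' p" for c p
      by (simp add: L'_def sum_distrib_left mult.assoc)
    show "L' (lstar p) = cnj (L' p)" for p
    proof -
      have "L' (lstar p) = (\<Sum>k\<in>E. coef (lstar p) (- k) * L (mono2 (- k)))"
        unfolding L'_def
        \<comment> \<open>\<open>E\<close> is symmetric under negation.\<close>
        by (rule sum.reindex_bij_witness[of _ uminus uminus]) (auto simp: E_def)
      also have "\<dots> = cnj (L' p)"
        using herm unfolding L'_def cnj_sum
        by (intro sum.cong) (auto simp: E_def hermitian_functional_def)
      finally show ?thesis .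
    qed
    show "0 < linner L' p p" if "p \<in> LPi_hat N M" "p \<noteq> 0" for p
    proof -
      have "p * lstar p \<in> LPi N M"
        using that(1) by (intro mult_lstar_in_LPi) (auto simp: LPi_hat_eq)
      then show ?thesis using pos[OF that] by (simp add: linner_def agree)
    qed
  qed
qed

lemma is_orthonormal_poly_cong:
  assumes agree: "\<And>p. p \<in> LPi N M \<Longrightarrow> L' p = L p" and I: "I \<subseteq> box (N + 1) (M + 1)"
  shows "is_orthonormal_poly L' I e p \<longleftrightarrow> is_orthonormal_poly L I e p"
proof -
  have "linner L' p q = linner L p q" if "p \<in> Pol I" "q \<in> Pol I" for p q
    using mult_lstar_in_LPi[OF Pol_mono[OF I that(1)] Pol_mono[OF I that(2)]]
    by (simp add: linner_def agree)
  then show ?thesis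
    by (auto simp: is_orthonormal_poly_def mono2_in_Pol)
qed

text \<open>Both functionals give the same defining predicate, so the definite descriptions
  coincide.\<close>

lemma
  assumes agree: "\<And>p. p \<in> LPi N M \<Longrightarrow> L' p = L p" and "n \<le> N" "m \<le> M"
  shows Phi_cong: "Phi L' n m = Phi L n m"
    and Phi_tilde_cong: "Phi_tilde L' n m = Phi_tilde L n m"
proof -
  have "phi L' n m l = phi L n m l" if "l \<le> m" for l
    unfolding phi_def
    by (intro arg_cong[where f = The] ext is_orthonormal_poly_cong[OF agree])
      (use assms(2,3) that in \<open>auto simp: box_def\<close>)
  then show "Phi L' n m = Phi L n m"
    by (auto simp: Phi_def)
  have "phi_tilde L' n m l = phi_tilde L n m l" if "l \<le> n" for l
    unfolding phi_tilde_def
    by (intro arg_cong[where f = The] ext is_orthonormal_poly_cong[OF agree])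
      (use assms(2,3) that in \<open>auto simp: box_def\<close>)
  then show "Phi_tilde L' n m = Phi_tilde L n m"
    by (auto simp: Phi_tilde_def)
qed

theorem lemma4p1:
  fixes L :: "laurent \<Rightarrow> complex" and N M n m :: nat and z w z1 w1 :: complex
  assumes "positive_definite N M L"
    and "1 \<le> n" "n \<le> N" "1 \<le> m" "m \<le> M"
  shows "vkernel (Phi_rev L n m) z w z1 w1 - cnj z1 * z * vkernel (Phi L n m) z w z1 w1
       = (1 - cnj z1 * z) * vkernel (Phi L n m) z w z1 w1
         + vkernel (Phi_rev L (n - 1) m) z w z1 w1
         - cnj z1 * z * vkernel (Phi L (n - 1) m) z w z1 w1
     \<and> (1 - cnj z1 * z) * vkernel (Phi L n m) z w z1 w1
         + vkernel (Phi_rev L (n - 1) m) z w z1 w1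
         - cnj z1 * z * vkernel (Phi L (n - 1) m) z w z1 w1
       = (1 - cnj z1 * z) * vkernel (Phi_tilde L n m) z w z1 w1
         + vkernel (Phi_rev L n (m - 1)) z w z1 w1
         - cnj z1 * z * vkernel (Phi L n (m - 1)) z w z1 w1"
proof -
  obtain L' where "laurent_inner L' N M" and agree: "\<And>p. p \<in> LPi N M \<Longrightarrow> L' p = L p"
    using laurent_inner_extension[OF assms(1)] by blast
  then interpret laurent_inner L' N M by simp
  have Phi_cong: "Phi L i j = Phi L' i j" "Phi_tilde L i j = Phi_tilde L' i j" if "i \<le> N" "j \<le> M" for i j
    using Phi_cong[of N M L' L] Phi_tilde_cong[of N M L' L] agree that by simp_all
  have Phi_rev_cong: "Phi_rev L i j = Phi_rev L' i j" if "i \<le> N" "j \<le> M" for i j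
    using Phi_cong[OF that] by (simp add: Phi_rev_def)
  have le: "n - 1 \<le> N" "m - 1 \<le> M" using assms by auto
  \<comment> \<open>With these index shifts, each reversed kernel minus \<open>cnj z1 * z\<close>
    times its companion becomes \<open>1 - cnj z1 * z\<close> times one \<open>kernel\<close> value,
    and the rest telescopes.\<close>
  have Suc: "n - 1 + 1 = n" "m - 1 + 1 = m" using assms by auto
  show ?thesis
    by (simp only: Phi_cong Phi_rev_cong vkernel_Phi vkernel_Phi_rev vkernel_Phi_tilde
        assms le Suc) (simp add: algebra_simps)
qed

end
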